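(* Let $k$ and $s$ be fixed positive integers and, for $n\ge 1$, let $b_n^{(k,s)}$ be the number of vertices of the polytope $P_{n,k,s}$. The following hold as identities of formal power series (right-hand sides expanded at $x=0$). (1) If $s\in\{\lceil k/2\rceil,\ldots,k\}$, then $$1+\sum_{n\geq 1} b^{(k,s)}_{n} x^n=\frac{1}{1-kx+(k-s)(k-s-1)x^2}.$$ (2) If $k=s(r+1)$ for a nonnegative integer $r$, then $$1+\sum_{n\geq 1} b_{n}^{(k,s)} x^n=\frac{1+(rs-s-2)x-(rs-1)x^{2}+sx^{r+1}}{1-2(s+1)x+(s+1)^2x^{2}+sx^{r+1}-s^{2}(r+1)x^{r+2}+s(rs-1)x^{r+3}}.$$ In particular, if $s=1$, $$1+\sum_{n\geq 1} b_{n}^{(k,1)} x^n=\frac{1+(k-4)x-(k-2)x^2+x^k}{1-4x+4x^{2}+x^{k}-kx^{k+1}+(k-2)x^{k+2}}.$$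
   Context: For positive integers $n,k,s$ let $K=s(n-1)+k$ and let $e_0,\ldots,e_{K-1}$ be the standard basis of $\mathbb{R}^{K}$. For $0\le i\le n-1$ let $\lambda_i=\{si,si+1,\ldots,si+k-1\}$ and $\Delta_{\lambda_i}=\operatorname{conv}\{e_j: j\in\lambda_i\}$. Then $P_{n,k,s}=\sum_{i=0}^{n-1}\Delta_{\lambda_i}$ (Minkowski sum). *)

theory Defs
  imports
    "HOL-Analysis.Analysis"
    "HOL-Analysis.Finite_Function_Topology"
    "HOL-Computational_Algebra.Formal_Power_Series"
begin

text \<open>
  The polytopes live in spaces whose dimension K = s (n - 1) + k varies with n, while the theorem
  collects all n into one generating function.  We therefore work in the single real vector space
  of finitely supported sequences, identifying the K-dimensional coordinate space with the linear
  span of the first K unit vectors.  Convex hulls, Minkowski sums and vertices do not depend on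
  the ambient space.
\<close>

definition std_basis :: "nat \<Rightarrow> (nat \<Rightarrow>\<^sub>0 real)"
  where "std_basis j = Poly_Mapping.single j 1"

definition block :: "nat \<Rightarrow> nat \<Rightarrow> nat \<Rightarrow> nat set"
  where "block k s i = {s * i..<s * i + k}"

definition simplex_of :: "nat set \<Rightarrow> (nat \<Rightarrow>\<^sub>0 real) set"
  where "simplex_of J = convex hull (std_basis ` J)"

text \<open>The sum below is the Minkowski sum of sets, with 0 = {0} as the empty sum.\<close>

definition minkowski_P :: "nat \<Rightarrow> nat \<Rightarrow> nat \<Rightarrow> (nat \<Rightarrow>\<^sub>0 real) set"
  where "minkowski_P n k s = (\<Sum>i<n. simplex_of (block k s i))"

text \<open>Vertices, i.e. the points v such that {v} is a face (see face_of_singleton).\<close>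

definition num_vertices :: "nat \<Rightarrow> nat \<Rightarrow> nat \<Rightarrow> nat"
  where "num_vertices n k s = card {v. v extreme_point_of minkowski_P n k s}"

definition vertex_gf :: "nat \<Rightarrow> nat \<Rightarrow> real fps"
  where "vertex_gf k s = 1 + Abs_fps (\<lambda>n. if n \<ge> 1 then of_nat (num_vertices n k s) else 0)"

text \<open>Sanity check: minkowski_P n k s lies in the span of the first s (n - 1) + k unit vectors.\<close>

lemma block_subset:
  assumes "i < n"
  shows "block k s i \<subseteq> {..<s * (n - 1) + k}"
proof -
  have "s * i \<le> s * (n - 1)" using assms by (intro mult_le_mono2) simp
  then show ?thesis unfolding block_def by (intro subsetI) (simp only: atLeastLessThan_iff lessThan_iff, linarith)
qed

lemma minkowski_P_subset_span: "minkowski_P n k s \<subseteq> span (std_basis ` {..<s * (n - 1) + k})"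
proof -
  let ?V = "span (std_basis ` {..<s * (n - 1) + k})"
  have simplex: "simplex_of (block k s i) \<subseteq> ?V" if "i < n" for i
    unfolding simplex_of_def
    by (intro order_trans[OF convex_hull_subset_span] span_mono image_mono block_subset that)
  have "(\<Sum>i<m. simplex_of (block k s i)) \<subseteq> ?V" if "m \<le> n" for m
    using that
  proof (induction m)
    case 0
    then show ?case by (simp add: span_0)
  next
    case (Suc m)
    then show ?case
      using simplex[of m] by (auto simp: set_plus_def intro!: span_add)
  qed
  then show ?thesis by (simp add: minkowski_P_def)
qed

end

theory Submission
  imports Defs
begin

text \<open>
  A vertex of the Minkowski sum is a sum of unit vectors \<open>e (f i)\<close> with \<open>f i\<close> in block i. Because the
  blocks are intervals of equal length moving to the right, the only obstruction to being a vertex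
  is local: for two consecutive blocks, \<open>f i\<close> and \<open>f (i + 1)\<close> must not be distinct elements of
  the intersection. In terms of the offsets \<open>g = f i - s * i\<close> the admissible choices are thus the
  walks of a Markov chain in which an offset below s may be followed by anything, and an offset
  \<open>g \<ge> s\<close> only by \<open>g - s\<close> or by one of the top s offsets. The generating function of all walks is
  determined by that of the walks ending below s. The latter is found directly if \<open>k \<le> 2 * s\<close>, since
  then every offset from s on is a top offset, and by descending through the levels \<open>g div s\<close> if s
  divides k.
\<close>

subsection \<open>Vertices as compatible choices\<close>

definition choice_point :: "nat \<Rightarrow> (nat \<Rightarrow> nat) \<Rightarrow> (nat \<Rightarrow>\<^sub>0 real)"
  where "choice_point n f = (\<Sum>i<n. std_basis (f i))"

text \<open>For \<open>u\<close> in block i and \<open>v\<close> in block i + 1, the second disjunct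
  puts \<open>u\<close> outside block i + 1 and the third puts \<open>v\<close> outside block
  i.\<close>

definition compatible :: "nat \<Rightarrow> nat \<Rightarrow> nat \<Rightarrow> nat \<Rightarrow> nat \<Rightarrow> bool"
  where "compatible k s i u v \<longleftrightarrow> u = v \<or> u < s * Suc i \<or> s * i + k \<le> v"

definition compatible_choices :: "nat \<Rightarrow> nat \<Rightarrow> nat \<Rightarrow> (nat \<Rightarrow> nat) set"
  where "compatible_choices k s n =
    {f \<in> Pi\<^sub>E {..<n} (block k s). \<forall>i. Suc i < n \<longrightarrow> compatible k s i (f i) (f (Suc i))}"

text \<open>Convex hulls commute with Minkowski sums, so it suffices to add up the finite vertex
  sets of the simplices.\<close>

lemma minkowski_P_eq_convex_hull:
  "minkowski_P n k s = convex hull (choice_point n ` Pi\<^sub>E {..<n} (block k s))"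
proof -
  have "(\<Sum>i<n. std_basis ` block k s i) = choice_point n ` Pi\<^sub>E {..<n} (block k s)" (is "?L = ?R")
  proof
    show "?L \<subseteq> ?R"
    proof
      fix x assume "x \<in> ?L"
      then obtain t where t: "x = (\<Sum>i<n. t i)" "\<forall>i<n. t i \<in> std_basis ` block k s i"
        by (auto simp: set_sum_alt)
      then have "\<forall>i. \<exists>u. i < n \<longrightarrow> u \<in> block k s i \<and> t i = std_basis u"
        by blast
      then obtain f where f: "\<forall>i<n. f i \<in> block k s i \<and> t i = std_basis (f i)"
        using choice[where Q = "\<lambda>i u. i < n \<longrightarrow> u \<in> block k s i \<and> t i = std_basis u"] by blast
      have "x = choice_point n (restrict f {..<n})"
        using t(1) f by (simp add: choice_point_def)
      then show "x \<in> ?R" using f by (auto intro!: image_eqI)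
    qed
    show "?R \<subseteq> ?L"
      by (force simp: set_sum_alt choice_point_def PiE_iff)
  qed
  then show ?thesis
    by (simp add: minkowski_P_def simplex_of_def flip: convex_hull_set_sum)
qed

lemma choice_point_in_minkowski_P:
  "f \<in> Pi\<^sub>E {..<n} (block k s) \<Longrightarrow> choice_point n f \<in> minkowski_P n k s"
  unfolding minkowski_P_eq_convex_hull by (intro hull_inc imageI)

lemma choice_point_fun_upd:
  assumes "j < n"
  shows "choice_point n (f(j := v)) = choice_point n f - std_basis (f j) + std_basis v"
proof -
  have *: "choice_point n g = std_basis (g j) + (\<Sum>i\<in>{..<n} - {j}. std_basis (g i))" for g
    unfolding choice_point_def using assms by (intro sum.remove) auto
  have "(\<Sum>i\<in>{..<n} - {j}. std_basis ((f(j := v)) i)) = (\<Sum>i\<in>{..<n} - {j}. std_basis (f i))"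
    by (intro sum.cong) auto
  then show ?thesis by (simp add: *[of f] *[of "f(j := v)"] del: fun_upd_apply) (simp add: algebra_simps)
qed

lemma std_basis_eq_iff [simp]: "std_basis i = std_basis j \<longleftrightarrow> i = j"
proof
  assume "std_basis i = std_basis j"
  then have "Poly_Mapping.keys (std_basis i) = Poly_Mapping.keys (std_basis j)" by simp
  then show "i = j" by (simp add: std_basis_def)
qed simp

text \<open>If both chosen vertices lie in both of two consecutive simplices, exchanging either of them
  for the other shifts the point in opposite directions.\<close>

lemma extreme_point_imp_compatible:
  assumes f: "f \<in> Pi\<^sub>E {..<n} (block k s)"
    and ext: "choice_point n f extreme_point_of minkowski_P n k s"
  shows "f \<in> compatible_choices k s n"
proof (rule ccontr)
  assume "f \<notin> compatible_choices k s n"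
  then obtain i where i: "Suc i < n" and bad: "\<not> compatible k s i (f i) (f (Suc i))"
    using f by (auto simp: compatible_choices_def)
  have mem: "f i \<in> block k s i" "f (Suc i) \<in> block k s (Suc i)"
    using f i by (auto simp: PiE_iff)
  then have mem': "f (Suc i) \<in> block k s i" "f i \<in> block k s (Suc i)" and neq: "f i \<noteq> f (Suc i)"
    using bad by (auto simp: compatible_def block_def)
  define a where "a = choice_point n (f(i := f (Suc i)))"
  define b where "b = choice_point n (f(Suc i := f i))"
  define d where "d = std_basis (f (Suc i)) - std_basis (f i)"
  have P: "a \<in> minkowski_P n k s" "b \<in> minkowski_P n k s"
    using f i mem' unfolding a_def b_def
    by (intro choice_point_in_minkowski_P; auto simp: PiE_iff extensional_def)+
  have ab: "a = choice_point n f + d" "b = choice_point n f - d"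
    using i by (simp_all add: a_def b_def d_def choice_point_fun_upd)
  have "d \<noteq> 0" using neq by (simp add: d_def)
  have "a \<noteq> b"
  proof
    assume "a = b"
    then have "2 *\<^sub>R d = 0" unfolding ab scaleR_2 by (simp add: algebra_simps)
    then show False using \<open>d \<noteq> 0\<close> by simp
  qed
  then have "midpoint a b \<in> open_segment a b" by simp
  moreover have "midpoint a b = choice_point n f"
  proof -
    have "a + b = 2 *\<^sub>R choice_point n f" by (simp add: ab scaleR_2)
    then show ?thesis by (simp add: midpoint_def)
  qed
  ultimately show False using ext P by (auto simp: extreme_point_of_def)
qed

text \<open>A linear functional separating the point of a compatible choice from all others is built by
  giving the coordinate chosen at step i the weight \<open>height k s f i\<close>, and every unchosen coordinate
  a weight below all heights. When the choice changes, compatibility says that at most one of the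
  old and the new coordinate lies in both blocks, which fixes the direction of the step.\<close>

primrec height :: "nat \<Rightarrow> nat \<Rightarrow> (nat \<Rightarrow> nat) \<Rightarrow> nat \<Rightarrow> real" where
  "height k s f 0 = 0"
| "height k s f (Suc i) = height k s f i +
     (if f (Suc i) = f i then 0 else if f (Suc i) < s * i + k then -1 else 1)"

lemma height_ge: "- real i \<le> height k s f i"
  by (induction i) auto

lemma compatible_choices_block:
  "f \<in> compatible_choices k s n \<Longrightarrow> i < n \<Longrightarrow> s * i \<le> f i \<and> f i < s * i + k"
  by (auto simp: compatible_choices_def PiE_iff block_def)

lemma compatible_choices_step:
  assumes "f \<in> compatible_choices k s n" "Suc i < n"
  shows "f i = f (Suc i) \<or> f i < s * Suc i \<or> s * i + k \<le> f (Suc i)"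
  using assms by (auto simp: compatible_choices_def compatible_def)

text \<open>If two consecutive choices differ, one of the bounds \<open>s * Suc i\<close> and
  \<open>s * i + k\<close> separates them, the first being the lower end of block i + 1 and the
  second the upper end of block i.\<close>

lemma compatible_choices_mono:
  assumes f: "f \<in> compatible_choices k s n" and "i \<le> j" "j < n"
  shows "f i \<le> f j"
  using assms(2,3)
proof (induction j rule: dec_induct)
  case (step j)
  then show ?case
    using compatible_choices_step[OF f, of j] compatible_choices_block[OF f, of j]
      compatible_choices_block[OF f, of "Suc j"] by auto
qed simp

text \<open>By monotonicity all choices from i to j stay below \<open>s * i + k\<close>, so each
  change on the way goes to a coordinate of the preceding block and takes the -1 branch of
  \<open>height\<close>.\<close>

lemma height_right:
  assumes f: "f \<in> compatible_choices k s n" and "i \<le> j" "j < n" "f j < s * i + k"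
  shows "f i = f j \<and> height k s f j = height k s f i \<or> f i < f j \<and> height k s f j < height k s f i"
  using assms(2-4)
proof (induction j rule: dec_induct)
  case (step m)
  have "s * i \<le> s * m" using step.hyps by simp
  moreover have "f m \<le> f (Suc m)" using compatible_choices_mono[OF f] step.prems by simp
  moreover have "m < n" "f m < s * i + k" "f (Suc m) < s * m + k"
    using step.prems calculation by linarith+
  ultimately show ?case using step.IH step.prems by auto
qed simp

text \<open>Mirror image of \<open>height_right\<close>: each choice before j is already at least
  \<open>s * j\<close>, hence lies in the next block as well. Compatibility then forces a change to
  leave the current block, which takes the +1 branch.\<close>

lemma height_left:
  assumes f: "f \<in> compatible_choices k s n" and "i \<le> j" "j < n" "s * j \<le> f i"
  shows "f i = f j \<and> height k s f j = height k s f i \<or> f i < f j \<and> height k s f i < height k s f j"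
  using assms(2-4)
proof (induction j rule: dec_induct)
  case (step m)
  have le: "f i \<le> f m" "f m \<le> f (Suc m)"
    using compatible_choices_mono[OF f] step.hyps step.prems by simp_all
  moreover have "f m = f (Suc m) \<or> s * m + k \<le> f (Suc m)"
    using compatible_choices_step[OF f, of m] step.prems le by auto
  moreover have "m < n" "s * m \<le> f i" using step.prems by simp_all
  ultimately show ?case using step.IH by auto
qed simp

lemma height_less:
  assumes f: "f \<in> compatible_choices k s n" and "i < n" "j < n" "f j \<in> block k s i" "f j \<noteq> f i"
  shows "height k s f j < height k s f i"
proof (cases "i \<le> j")
  case True
  then show ?thesis using height_right[OF f, of i j] assms by (auto simp: block_def)
next
  case False
  then show ?thesis using height_left[OF f, of j i] assms by (auto simp: block_def)
qed

text \<open>Makes the weight of a coordinate well defined when it is chosen at several steps; by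
  monotonicity the choice is constant between them.\<close>

lemma height_cong:
  assumes f: "f \<in> compatible_choices k s n" and "i < n" "j < n" "f i = f j"
  shows "height k s f i = height k s f j"
proof (cases "i \<le> j")
  case True
  then show ?thesis using height_right[OF f, of i j] assms compatible_choices_block[OF f, of i] by auto
next
  case False
  then show ?thesis using height_right[OF f, of j i] assms compatible_choices_block[OF f, of j] by auto
qed

lemma compatible_imp_separating_weight:
  assumes f: "f \<in> compatible_choices k s n"
  obtains w :: "nat \<Rightarrow> real"
  where "\<And>i j. i < n \<Longrightarrow> j \<in> block k s i \<Longrightarrow> j \<noteq> f i \<Longrightarrow> w j < w (f i)"
proof
  \<comment> \<open>By \<open>height_cong\<close> it does not matter which step
    \<open>inv_into\<close> picks. The default - n lies below all heights, since the height at i < n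
    is at least - i.\<close>
  define w where "w j = (if j \<in> f ` {..<n} then height k s f (inv_into {..<n} f j) else - real n)" for j
  have w: "w (f i) = height k s f i" if "i < n" for i
    unfolding w_def using that height_cong[OF f, of "inv_into {..<n} f (f i)" i]
      inv_into_into[of "f i" f "{..<n}"] f_inv_into_f[of "f i" f "{..<n}"] by auto
  show "w j < w (f i)" if *: "i < n" "j \<in> block k s i" "j \<noteq> f i" for i j
  proof (cases "j \<in> f ` {..<n}")
    case True
    then obtain l where "l < n" "j = f l" by auto
    then show ?thesis using height_less[OF f, of i l] * by (simp add: w)
  next
    case False
    then have "w j = - real n" by (simp add: w_def)
    then show ?thesis using height_ge[of i k s f] * by (simp add: w)
  qed
qed

section \<open>Linear functionals that single out the vertices\<close>

definition weight_functional :: "nat \<Rightarrow> (nat \<Rightarrow> real) \<Rightarrow> (nat \<Rightarrow>\<^sub>0 real) \<Rightarrow> real"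
  where "weight_functional m w x = (\<Sum>j<m. Poly_Mapping.lookup x j * w j)"

lemma lookup_scaleR:
  fixes x :: "'a \<Rightarrow>\<^sub>0 'b::real_vector"
  shows "Poly_Mapping.lookup (c *\<^sub>R x) i = c *\<^sub>R Poly_Mapping.lookup x i"
proof -
  have "finite {i. c *\<^sub>R Poly_Mapping.lookup x i \<noteq> 0}"
    by (rule finite_subset[OF _ finite_lookup[of x]]) auto
  then show ?thesis by (simp add: scaleR_poly_mapping_def)
qed

lemma linear_weight_functional: "linear (weight_functional m w)"
proof (rule linearI)
  show "weight_functional m w (x + y) = weight_functional m w x + weight_functional m w y" for x y
    by (simp add: weight_functional_def lookup_add distrib_right sum.distrib)
  show "weight_functional m w (c *\<^sub>R x) = c *\<^sub>R weight_functional m w x" for c x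
    by (simp add: weight_functional_def lookup_scaleR sum_distrib_left mult.assoc)
qed

lemma weight_functional_std_basis: "j < m \<Longrightarrow> weight_functional m w (std_basis j) = w j"
proof -
  have "Poly_Mapping.lookup (std_basis j) i * w i = (if i = j then w i else 0)" for i
    by (simp add: std_basis_def lookup_single when_def)
  then show "j < m \<Longrightarrow> ?thesis" by (simp add: weight_functional_def)
qed

text \<open>All blocks end below \<open>s * (n - 1) + k\<close>, so the cut-off in the functional
  loses nothing.\<close>

lemma weight_functional_choice_point:
  assumes "f \<in> Pi\<^sub>E {..<n} (block k s)"
  shows "weight_functional (s * (n - 1) + k) w (choice_point n f) = (\<Sum>i<n. w (f i))"
proof -
  have "weight_functional (s * (n - 1) + k) w (choice_point n f)
      = (\<Sum>i<n. weight_functional (s * (n - 1) + k) w (std_basis (f i)))"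
    unfolding choice_point_def by (rule linear_sum[OF linear_weight_functional])
  also have "\<dots> = (\<Sum>i<n. w (f i))"
    using assms block_subset[of _ n k s]
    by (intro sum.cong refl weight_functional_std_basis) (auto simp: PiE_iff)
  finally show ?thesis .
qed

text \<open>The weight sum is maximised term by term: f is the strict maximiser in each block, and g
  loses wherever it differs. Strictness serves both extremality and injectivity.\<close>

lemma compatible_imp_weight_less:
  assumes f: "f \<in> compatible_choices k s n"
  obtains w where "\<And>g. g \<in> Pi\<^sub>E {..<n} (block k s) \<Longrightarrow> g \<noteq> f \<Longrightarrow>
    weight_functional (s * (n - 1) + k) w (choice_point n g)
      < weight_functional (s * (n - 1) + k) w (choice_point n f)"
proof -
  obtain w :: "nat \<Rightarrow> real" where
    w: "\<And>i j. i < n \<Longrightarrow> j \<in> block k s i \<Longrightarrow> j \<noteq> f i \<Longrightarrow> w j < w (f i)"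
    using compatible_imp_separating_weight[OF f] by blast
  have f': "f \<in> Pi\<^sub>E {..<n} (block k s)" using f by (simp add: compatible_choices_def)
  have "(\<Sum>i<n. w (g i)) < (\<Sum>i<n. w (f i))" if g: "g \<in> Pi\<^sub>E {..<n} (block k s)" "g \<noteq> f" for g
  proof (rule sum_strict_mono_ex1)
    have mem: "g i \<in> block k s i" if "i < n" for i using g that by (auto simp: PiE_iff)
    show "\<forall>i\<in>{..<n}. w (g i) \<le> w (f i)" using w mem by (metis lessThan_iff less_imp_le order_refl)
    obtain i where "i < n" "g i \<noteq> f i" using g f' by (metis PiE_ext lessThan_iff)
    then show "\<exists>i\<in>{..<n}. w (g i) < w (f i)" using w mem by blast
  qed simp
  then show thesis using that[of w] weight_functional_choice_point f' by metis
qed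

lemma extreme_point_of_subset:
  "x extreme_point_of T \<Longrightarrow> S \<subseteq> T \<Longrightarrow> x \<in> S \<Longrightarrow> x extreme_point_of S"
  by (auto simp: extreme_point_of_def)

text \<open>The hull lies in the open half-space below \<open>L p\<close> with p added. That set is
  convex and stays convex when p is removed, so p is extreme in it.\<close>

lemma extreme_point_of_convex_hull_if_linear_less:
  fixes L :: "'a::real_vector \<Rightarrow> real"
  assumes L: "linear L" and "p \<in> S" and less: "\<And>x. x \<in> S \<Longrightarrow> x \<noteq> p \<Longrightarrow> L x < L p"
  shows "p extreme_point_of convex hull S"
proof (rule extreme_point_of_subset)
  let ?H = "{x. L x < L p}"
  have H: "convex ?H"
  proof -
    have "?H = L -` {..<L p}" by auto
    then show ?thesis using convex_linear_vimage[OF L] by simp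
  qed
  have conv: "convex (insert p ?H)"
  proof (rule convexI)
    fix x y and u v :: real
    assume xy: "x \<in> insert p ?H" "y \<in> insert p ?H" and uv: "0 \<le> u" "0 \<le> v" "u + v = 1"
    have le: "L x \<le> L p" "L y \<le> L p" using xy by auto
    have eq: "L (u *\<^sub>R x + v *\<^sub>R y) = u * L x + v * L y"
      using L by (simp add: linear_add linear_scale)
    have split: "L p = u * L p + v * L p" using uv by (metis distrib_right mult_1)
    show "u *\<^sub>R x + v *\<^sub>R y \<in> insert p ?H"
    proof (cases "u = 0 \<or> v = 0 \<or> x = p \<and> y = p")
      case True
      then show ?thesis using xy uv by (auto simp flip: scaleR_left_distrib)
    next
      case False
      then have "u > 0" "v > 0" "L x < L p \<or> L y < L p" using xy uv by auto
      then have "u * L x + v * L y < u * L p + v * L p"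
        using le by (metis add_le_less_mono add_less_le_mono mult_le_cancel_left_pos mult_less_cancel_left_pos)
      then show ?thesis using eq split by simp
    qed
  qed
  show "p extreme_point_of insert p ?H"
    using conv H by (simp add: extreme_point_of_stillconvex)
  show "convex hull S \<subseteq> insert p ?H"
    using less by (intro hull_minimal conv) auto
  show "p \<in> convex hull S" using \<open>p \<in> S\<close> by (rule hull_inc)
qed

lemma extreme_points_minkowski_P:
  "{v. v extreme_point_of minkowski_P n k s} = choice_point n ` compatible_choices k s n"
proof (intro equalityI subsetI)
  fix v assume v: "v \<in> {v. v extreme_point_of minkowski_P n k s}"
  then obtain f where "f \<in> Pi\<^sub>E {..<n} (block k s)" "v = choice_point n f"
    using extreme_point_of_convex_hull unfolding minkowski_P_eq_convex_hull by blast
  then show "v \<in> choice_point n ` compatible_choices k s n"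
    using extreme_point_imp_compatible v by blast
next
  fix v assume "v \<in> choice_point n ` compatible_choices k s n"
  then obtain f where f: "f \<in> compatible_choices k s n" and v: "v = choice_point n f" by blast
  obtain w where w: "\<And>g. g \<in> Pi\<^sub>E {..<n} (block k s) \<Longrightarrow> g \<noteq> f \<Longrightarrow>
    weight_functional (s * (n - 1) + k) w (choice_point n g)
      < weight_functional (s * (n - 1) + k) w (choice_point n f)"
    using compatible_imp_weight_less[OF f] by blast
  have "v extreme_point_of minkowski_P n k s"
    unfolding v minkowski_P_eq_convex_hull
  proof (rule extreme_point_of_convex_hull_if_linear_less[OF linear_weight_functional])
    show "choice_point n f \<in> choice_point n ` Pi\<^sub>E {..<n} (block k s)"
      using f by (intro imageI) (simp add: compatible_choices_def)
  next
    fix x assume "x \<in> choice_point n ` Pi\<^sub>E {..<n} (block k s)" "x \<noteq> choice_point n f"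
    then show "weight_functional (s * (n - 1) + k) w x
        < weight_functional (s * (n - 1) + k) w (choice_point n f)"
      using w by blast
  qed
  then show "v \<in> {v. v extreme_point_of minkowski_P n k s}" by simp
qed

text \<open>On all choices injectivity can fail, since exchanging two common coordinates of
  overlapping blocks keeps the sum. A compatible choice, however, is the only maximiser of its
  functional.\<close>

lemma inj_on_choice_point: "inj_on (choice_point n) (compatible_choices k s n)"
proof (rule inj_onI, rule ccontr)
  fix f g assume fg: "f \<in> compatible_choices k s n" "g \<in> compatible_choices k s n"
    "choice_point n f = choice_point n g" "f \<noteq> g"
  then have "g \<in> Pi\<^sub>E {..<n} (block k s)" by (simp add: compatible_choices_def)
  then show False using compatible_imp_weight_less[OF fg(1)] fg(3,4) by (metis order_less_irrefl)
qed

lemma num_vertices_eq: "num_vertices n k s = card (compatible_choices k s n)"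
  unfolding num_vertices_def extreme_points_minkowski_P by (rule card_image[OF inj_on_choice_point])

subsection \<open>Counting walks\<close>

text \<open>Walks record the offsets \<open>f i - s * i < k\<close> of a compatible choice; \<open>walks k s n h\<close> counts
  those with n steps, hence n + 1 summands, that end at offset h.\<close>

definition walk_step :: "nat \<Rightarrow> nat \<Rightarrow> nat \<Rightarrow> nat \<Rightarrow> bool"
  where "walk_step k s g h \<longleftrightarrow> g = s + h \<or> g < s \<or> k \<le> s + h"

fun walks :: "nat \<Rightarrow> nat \<Rightarrow> nat \<Rightarrow> nat \<Rightarrow> nat" where
  "walks k s 0 h = 1"
| "walks k s (Suc n) h = (\<Sum>g | g < k \<and> walk_step k s g h. walks k s n g)"

lemma finite_compatible_choices: "finite (compatible_choices k s n)"
  unfolding compatible_choices_def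
  by (rule finite_subset[of _ "Pi\<^sub>E {..<n} (block k s)"]) (auto intro!: finite_PiE simp: block_def)

lemma bij_betw_extend_choice:
  assumes "v \<in> block k s (Suc n)"
  shows "bij_betw (\<lambda>f. f(Suc n := v))
    {f \<in> compatible_choices k s (Suc n). compatible k s n (f n) v}
    {f \<in> compatible_choices k s (Suc (Suc n)). f (Suc n) = v}"
\<comment> \<open>Choices are extensional, so forgetting the last value means resetting it to
  \<open>undefined\<close>.\<close>
proof (rule bij_betw_byWitness[where f' = "\<lambda>f. f(Suc n := undefined)"])
  show "\<forall>f\<in>{f \<in> compatible_choices k s (Suc n). compatible k s n (f n) v}.
      (f(Suc n := v))(Suc n := undefined) = f"
    by (auto simp: compatible_choices_def PiE_iff extensional_def)
qed (use assms in \<open>auto simp: compatible_choices_def PiE_iff extensional_def less_Suc_eq\<close>)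

lemma card_compatible_choices_last:
  "h < k \<Longrightarrow> card {f \<in> compatible_choices k s (Suc n). f n = s * n + h} = walks k s n h"
proof (induction n arbitrary: h)
  case 0
  then have "{f \<in> compatible_choices k s (Suc 0). f 0 = s * 0 + h} = {(\<lambda>_. undefined)(0 := h)}"
    by (auto simp: compatible_choices_def PiE_iff extensional_def block_def)
  then show ?case by simp
next
  case (Suc n)
  let ?v = "s * Suc n + h"
  let ?G = "{g. g < k \<and> walk_step k s g h}"
  let ?F = "\<lambda>g. {f \<in> compatible_choices k s (Suc n). f n = s * n + g}"
  have "card {f \<in> compatible_choices k s (Suc (Suc n)). f (Suc n) = ?v}
      = card {f \<in> compatible_choices k s (Suc n). compatible k s n (f n) ?v}"
    by (rule bij_betw_same_card[OF bij_betw_extend_choice, symmetric]) (use Suc.prems in \<open>simp add: block_def\<close>)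
  \<comment> \<open>Split by the offset g of the last but one choice.\<close>
  also have "{f \<in> compatible_choices k s (Suc n). compatible k s n (f n) ?v} = (\<Union>g\<in>?G. ?F g)"
  proof (intro equalityI subsetI)
    fix f assume f: "f \<in> {f \<in> compatible_choices k s (Suc n). compatible k s n (f n) ?v}"
    then have "s * n \<le> f n \<and> f n < s * n + k" using compatible_choices_block by blast
    then show "f \<in> (\<Union>g\<in>?G. ?F g)"
      using f by (intro UN_I[of "f n - s * n"]) (auto simp: compatible_def walk_step_def)
  qed (auto simp: compatible_def walk_step_def)
  also have "card \<dots> = (\<Sum>g\<in>?G. card (?F g))"
    using finite_compatible_choices by (intro card_UN_disjoint) auto
  also have "\<dots> = (\<Sum>g\<in>?G. walks k s n g)"
    using Suc.IH by (intro sum.cong) auto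
  finally show ?case by simp
qed

lemma num_vertices_Suc: "num_vertices (Suc n) k s = (\<Sum>h<k. walks k s n h)"
proof -
  let ?F = "\<lambda>h. {f \<in> compatible_choices k s (Suc n). f n = s * n + h}"
  have "compatible_choices k s (Suc n) = (\<Union>h\<in>{..<k}. ?F h)"
  proof (intro equalityI subsetI)
    fix f assume f: "f \<in> compatible_choices k s (Suc n)"
    then have "s * n \<le> f n \<and> f n < s * n + k" using compatible_choices_block by blast
    then show "f \<in> (\<Union>h\<in>{..<k}. ?F h)" using f by (intro UN_I[of "f n - s * n"]) auto
  qed auto
  then have "num_vertices (Suc n) k s = card (\<Union>h\<in>{..<k}. ?F h)" by (simp add: num_vertices_eq)
  also have "\<dots> = (\<Sum>h<k. card (?F h))"
    using finite_compatible_choices by (intro card_UN_disjoint) auto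
  also have "\<dots> = (\<Sum>h<k. walks k s n h)"
    by (intro sum.cong) (auto simp: card_compatible_choices_last)
  finally show ?thesis .
qed

lemma num_vertices_one: "num_vertices (Suc 0) k s = k"
  by (simp add: num_vertices_Suc)

section \<open>Recurrences for the numbers of walks\<close>

definition low_walks :: "nat \<Rightarrow> nat \<Rightarrow> nat \<Rightarrow> nat"
  where "low_walks k s n = (\<Sum>g<s. walks k s n g)"

lemma low_walks_0: "low_walks k s 0 = s"
  by (simp add: low_walks_def)

text \<open>Transitions read backwards: the top s offsets accept every predecessor, any other h only
  \<open>s + h\<close> and the offsets below s.\<close>

lemma walks_Suc:
  assumes "s \<le> k" "h < k"
  shows "walks k s (Suc n) h = (if k \<le> s + h then num_vertices (Suc n) k s
           else walks k s n (s + h) + low_walks k s n)"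
proof (cases "k \<le> s + h")
  case True
  then have "{g. g < k \<and> walk_step k s g h} = {..<k}" by (auto simp: walk_step_def)
  then show ?thesis using True by (simp add: num_vertices_Suc)
next
  case False
  then have "{g. g < k \<and> walk_step k s g h} = insert (s + h) {..<s}"
    using assms by (auto simp: walk_step_def)
  then show ?thesis using False by (simp add: low_walks_def)
qed

lemma sum_lessThan_add:
  fixes f :: "nat \<Rightarrow> 'a::comm_monoid_add"
  shows "sum f {..<a + b} = sum f {..<a} + (\<Sum>h<b. f (a + h))"
  by (induction b) (simp_all add: add.assoc)

text \<open>Sum \<open>walks_Suc\<close> over all end offsets. The terms at \<open>s + h\<close>
  make up all walks except the low ones; these are added on the left to avoid a subtraction.\<close>

lemma num_vertices_Suc_Suc:
  assumes "s \<le> k"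
  shows "num_vertices (Suc (Suc n)) k s + low_walks k s n
    = (s + 1) * num_vertices (Suc n) k s + (k - s) * low_walks k s n"
proof -
  have "num_vertices (Suc (Suc n)) k s
      = (\<Sum>h<k - s. walks k s (Suc n) h) + (\<Sum>h<s. walks k s (Suc n) (k - s + h))"
    using sum_lessThan_add[of "walks k s (Suc n)" "k - s" s] assms
    by (simp add: num_vertices_Suc del: walks.simps)
  also have "(\<Sum>h<k - s. walks k s (Suc n) h) = (\<Sum>h<k - s. walks k s n (s + h) + low_walks k s n)"
    using assms by (intro sum.cong) (auto simp: walks_Suc simp del: walks.simps)
  also have "(\<Sum>h<s. walks k s (Suc n) (k - s + h)) = (\<Sum>h<s. num_vertices (Suc n) k s)"
    using assms by (intro sum.cong) (auto simp: walks_Suc simp del: walks.simps)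
  finally have *: "num_vertices (Suc (Suc n)) k s
    = (\<Sum>h<k - s. walks k s n (s + h)) + (k - s) * low_walks k s n + s * num_vertices (Suc n) k s"
    by (simp add: sum.distrib)
  have "num_vertices (Suc n) k s = low_walks k s n + (\<Sum>h<k - s. walks k s n (s + h))"
    using sum_lessThan_add[of "walks k s n" s "k - s"] assms
    by (simp add: num_vertices_Suc low_walks_def)
  then show ?thesis using * by simp
qed

text \<open>If \<open>k \<le> 2 * s\<close>, each of the k - s offsets from s on is a top
  offset.\<close>

lemma low_walks_Suc:
  assumes "s \<le> k" "k \<le> 2 * s"
  shows "low_walks k s (Suc n) + (k - s) * num_vertices (Suc n) k s = num_vertices (Suc (Suc n)) k s"
proof -
  have "num_vertices (Suc (Suc n)) k s
      = low_walks k s (Suc n) + (\<Sum>h<k - s. walks k s (Suc n) (s + h))"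
    using sum_lessThan_add[of "walks k s (Suc n)" s "k - s"] assms
    by (simp add: num_vertices_Suc low_walks_def del: walks.simps)
  also have "(\<Sum>h<k - s. walks k s (Suc n) (s + h)) = (\<Sum>h<k - s. num_vertices (Suc n) k s)"
    using assms by (intro sum.cong) (auto simp: walks_Suc simp del: walks.simps)
  finally show ?thesis by simp
qed

text \<open>Level q collects the offsets with quotient q by s, so subtracting s moves down one
  level; level 0 gives \<open>low_walks\<close>.\<close>

definition level_walks :: "nat \<Rightarrow> nat \<Rightarrow> nat \<Rightarrow> nat \<Rightarrow> nat"
  where "level_walks k s q n = (\<Sum>h<s. walks k s n (s * q + h))"

lemma level_walks_0: "level_walks k s q 0 = s"
  by (simp add: level_walks_def)

lemma level_walks_Suc:
  assumes "k = s * (r + 1)" "q < r"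
  shows "level_walks k s q (Suc n) = level_walks k s (Suc q) n + s * low_walks k s n"
proof -
  \<comment> \<open>Hence no offset of a level q < r is a top offset.\<close>
  have "s * (q + 2) \<le> k" using assms by (simp only: mult_le_mono2)
  then have "walks k s (Suc n) (s * q + h) = walks k s n (s * Suc q + h) + low_walks k s n" if "h < s" for h
    using that assms by (subst walks_Suc) (auto simp: algebra_simps)
  then show ?thesis by (simp add: level_walks_def sum.distrib del: walks.simps)
qed

text \<open>Level r consists of exactly the top s offsets.\<close>

lemma level_walks_top_Suc:
  assumes "k = s * (r + 1)"
  shows "level_walks k s r (Suc n) = s * num_vertices (Suc n) k s"
proof -
  have "walks k s (Suc n) (s * r + h) = num_vertices (Suc n) k s" if "h < s" for h
    using that assms by (subst walks_Suc) (auto simp: algebra_simps)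
  then show ?thesis by (simp add: level_walks_def del: walks.simps)
qed

subsection \<open>Generating functions\<close>

text \<open>The shift by \<open>fps_X\<close> counts summands instead of steps, as in
  \<open>vertex_gf\<close>; the constant term 1 makes the recurrences hold from the start.
  \<open>level_gf\<close> is not shifted.\<close>

definition low_gf :: "nat \<Rightarrow> nat \<Rightarrow> real fps"
  where "low_gf k s = 1 + fps_X * Abs_fps (\<lambda>n. real (low_walks k s n))"

definition level_gf :: "nat \<Rightarrow> nat \<Rightarrow> nat \<Rightarrow> real fps"
  where "level_gf k s q = Abs_fps (\<lambda>n. real (level_walks k s q n))"

lemma vertex_gf_nth:
  "fps_nth (vertex_gf k s) n = (if n = 0 then 1 else real (num_vertices n k s))"
  by (simp add: vertex_gf_def)

lemma low_gf_nth: "fps_nth (low_gf k s) n = (case n of 0 \<Rightarrow> 1 | Suc m \<Rightarrow> real (low_walks k s m))"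
  by (simp add: low_gf_def split: nat.split)

text \<open>This encodes \<open>num_vertices_Suc_Suc\<close>. The constant terms of both series
  yield the coefficient (s + 1) + (k - s - 1) = k of \<open>fps_X\<close>, the count for one
  simplex.\<close>

lemma vertex_gf_eq:
  assumes "s \<le> k"
  shows "vertex_gf k s = 1 + fps_X * (of_nat (s + 1) * vertex_gf k s + (of_nat k - of_nat (s + 1)) * low_gf k s)"
proof (rule fps_ext)
  fix n
  \<comment> \<open>With scalars written as \<open>fps_const\<close> the coefficients can be read
    off; the \<open>of_nat\<close> form is restored at the end.\<close>
  let ?R = "fps_const (real (s + 1)) * vertex_gf k s + fps_const (real k - real (s + 1)) * low_gf k s"
  have "fps_nth (vertex_gf k s) n = fps_nth (1 + fps_X * ?R) n"
  proof (cases n)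
    case (Suc m)
    show ?thesis
    proof (cases m)
      case (Suc l)
      have "real (num_vertices (Suc (Suc l)) k s) + real (low_walks k s l)
          = (real s + 1) * real (num_vertices (Suc l) k s) + (real k - real s) * real (low_walks k s l)"
        using arg_cong[OF num_vertices_Suc_Suc[OF assms, of l], of real]
        by (simp only: of_nat_add of_nat_mult of_nat_diff[OF assms] of_nat_1)
      then show ?thesis
        by (simp add: \<open>n = Suc m\<close> Suc vertex_gf_nth low_gf_nth algebra_simps)
    qed (simp add: Suc vertex_gf_nth low_gf_nth num_vertices_one)
  qed (simp add: vertex_gf_nth)
  then show "fps_nth (vertex_gf k s) n = fps_nth (1 + fps_X *
      (of_nat (s + 1) * vertex_gf k s + (of_nat k - of_nat (s + 1)) * low_gf k s)) n"
    by (simp only: fps_of_nat[symmetric] fps_const_sub)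
qed

lemma low_gf_eq:
  assumes "s \<le> k" "k \<le> 2 * s"
  shows "low_gf k s = vertex_gf k s - (of_nat k - of_nat s) * fps_X * vertex_gf k s"
proof (rule fps_ext)
  fix n
  have "fps_nth (low_gf k s) n
      = fps_nth (vertex_gf k s - fps_const (real k - real s) * (fps_X * vertex_gf k s)) n"
  proof (cases n)
    case (Suc m)
    show ?thesis
    proof (cases m)
      case (Suc l)
      have "real (low_walks k s (Suc l)) + (real k - real s) * real (num_vertices (Suc l) k s)
          = real (num_vertices (Suc (Suc l)) k s)"
        using arg_cong[OF low_walks_Suc[OF assms, of l], of real]
        by (simp only: of_nat_add of_nat_mult of_nat_diff[OF assms(1)])
      then show ?thesis
        by (simp add: \<open>n = Suc m\<close> Suc vertex_gf_nth low_gf_nth algebra_simps)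
    qed (simp add: Suc vertex_gf_nth low_gf_nth num_vertices_one low_walks_0)
  qed (simp add: vertex_gf_nth low_gf_nth)
  then show "fps_nth (low_gf k s) n
      = fps_nth (vertex_gf k s - (of_nat k - of_nat s) * fps_X * vertex_gf k s) n"
    by (simp only: fps_of_nat[symmetric] fps_const_sub mult.assoc)
qed

lemma level_gf_eq:
  assumes "k = s * (r + 1)" "q < r"
  shows "level_gf k s q = of_nat s * low_gf k s + fps_X * level_gf k s (Suc q)"
proof (rule fps_ext)
  fix n
  have "fps_nth (level_gf k s q) n
      = fps_nth (fps_const (real s) * low_gf k s + fps_X * level_gf k s (Suc q)) n"
    by (cases n) (simp_all add: level_gf_def low_gf_nth level_walks_0 level_walks_Suc[OF assms])
  then show "fps_nth (level_gf k s q) n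
      = fps_nth (of_nat s * low_gf k s + fps_X * level_gf k s (Suc q)) n"
    by (simp only: fps_of_nat)
qed

lemma level_gf_top_eq:
  assumes "k = s * (r + 1)"
  shows "level_gf k s r = of_nat s * vertex_gf k s"
proof (rule fps_ext)
  fix n
  have "fps_nth (level_gf k s r) n = fps_nth (fps_const (real s) * vertex_gf k s) n"
    by (cases n) (simp_all add: level_gf_def vertex_gf_nth level_walks_0 level_walks_top_Suc[OF assms])
  then show "fps_nth (level_gf k s r) n = fps_nth (of_nat s * vertex_gf k s) n"
    by (simp only: fps_of_nat)
qed

text \<open>Unrolling \<open>level_gf_eq\<close> for m levels down from the top gives a geometric
  sum of powers of \<open>fps_X\<close>; the factor 1 - \<open>fps_X\<close> telescopes it.\<close>

lemma level_gf_sum: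
  assumes "k = s * (r + 1)" "m \<le> r"
  shows "(1 - fps_X) * level_gf k s (r - m) = of_nat s * low_gf k s * (1 - fps_X ^ m)
    + (1 - fps_X) * fps_X ^ m * (of_nat s * vertex_gf k s)"
  using assms(2)
proof (induction m)
  case 0
  then show ?case by (simp add: level_gf_top_eq[OF assms(1)])
next
  case (Suc m)
  have eq: "level_gf k s (r - Suc m) = of_nat s * low_gf k s + fps_X * level_gf k s (r - m)"
    using level_gf_eq[OF assms(1), of "r - Suc m"] Suc.prems by (simp add: Suc_diff_Suc)
  have "(1 - fps_X) * level_gf k s (r - Suc m)
      = (1 - fps_X) * (of_nat s * low_gf k s) + fps_X * ((1 - fps_X) * level_gf k s (r - m))"
    unfolding eq by (simp add: algebra_simps)
  also have "\<dots> = (1 - fps_X) * (of_nat s * low_gf k s) + fps_X * (of_nat s * low_gf k s * (1 - fps_X ^ m)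
    + (1 - fps_X) * fps_X ^ m * (of_nat s * vertex_gf k s))"
    using Suc by simp
  finally show ?case by (simp add: algebra_simps)
qed

lemma low_gf_eq_multiple:
  assumes "k = s * (r + 1)"
  shows "(1 - fps_X) * low_gf k s = (1 - fps_X) + fps_X * (of_nat s * low_gf k s * (1 - fps_X ^ r)
    + (1 - fps_X) * fps_X ^ r * (of_nat s * vertex_gf k s))"
proof -
  have "low_gf k s = 1 + fps_X * level_gf k s 0"
    by (simp add: low_gf_def level_gf_def low_walks_def level_walks_def)
  then have "(1 - fps_X) * low_gf k s = (1 - fps_X) + fps_X * ((1 - fps_X) * level_gf k s 0)"
    by (simp add: algebra_simps)
  then show ?thesis using level_gf_sum[OF assms, of r] by simp
qed

section \<open>Elimination and closed forms\<close>

lemma eliminate_low: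
  fixes A B X P s r :: "'a::comm_ring_1"
  assumes "A = 1 + X * ((s + 1) * A + (s * (r + 1) - (s + 1)) * B)"
    and "(1 - X) * B = (1 - X) + X * (s * B * (1 - P) + (1 - X) * P * (s * A))"
  shows "A * (1 - 2 * (s + 1) * X + (s + 1) ^ 2 * X ^ 2 + s * (X * P)
             - s ^ 2 * (r + 1) * (X ^ 2 * P) + s * (r * s - 1) * (X ^ 3 * P))
    = 1 + (r * s - s - 2) * X - (r * s - 1) * X ^ 2 + s * (X * P)"
proof -
  \<comment> \<open>P stands for \<open>X ^ r\<close> and is treated as an independent variable.
    Each equation is multiplied by the coefficient of B in the other, up to sign, so that B
    cancels.\<close>
  have "A * (1 - 2 * (s + 1) * X + (s + 1) ^ 2 * X ^ 2 + s * (X * P)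
             - s ^ 2 * (r + 1) * (X ^ 2 * P) + s * (r * s - 1) * (X ^ 3 * P))
      - (1 + (r * s - s - 2) * X - (r * s - 1) * X ^ 2 + s * (X * P))
    = ((1 - X) - s * X * (1 - P)) * (A - (1 + X * ((s + 1) * A + (s * (r + 1) - (s + 1)) * B)))
      + (r * s - 1) * X * ((1 - X) * B - ((1 - X) + X * (s * B * (1 - P) + (1 - X) * P * (s * A))))"
    by (simp add: algebra_simps power2_eq_square power3_eq_cube)
  also have "\<dots> = 0"
    unfolding right_minus_eq[THEN iffD2, OF assms(1)] right_minus_eq[THEN iffD2, OF assms(2)] by simp
  finally show ?thesis by simp
qed

lemma fps_eq_divideI:
  fixes A N D :: "real fps"
  assumes "A * D = N" "fps_nth D 0 \<noteq> 0"
  shows "A = N / D"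
proof -
  have "D \<noteq> 0" using assms(2) by auto
  then show ?thesis using assms(1) by auto
qed

lemma vertex_gf_half:
  assumes "s \<le> k" "k \<le> 2 * s"
  shows "vertex_gf k s = 1 / (1 - of_nat k * fps_X
               + (of_nat k - of_nat s) * (of_nat k - of_nat s - 1) * fps_X ^ 2)"
proof (rule fps_eq_divideI)
  \<comment> \<open>Stated for arbitrary series, so that \<open>algebra\<close> faces a pure ring
    identity: substitute B into the equation for A.\<close>
  have "A * (1 - k * X + (k - s) * (k - s - 1) * X ^ 2) = 1"
    if "A = 1 + X * ((s + 1) * A + (k - (s + 1)) * B)" "B = A - (k - s) * X * A"
    for A B X k s :: "real fps"
    using that by algebra
  then show "vertex_gf k s * (1 - of_nat k * fps_X
               + (of_nat k - of_nat s) * (of_nat k - of_nat s - 1) * fps_X ^ 2) = 1"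
    using vertex_gf_eq[OF assms(1)] low_gf_eq[OF assms] by (simp only: of_nat_add of_nat_1)
qed simp

lemma vertex_gf_multiple:
  assumes "k = s * (r + 1)"
  shows "vertex_gf k s =
        (1 + (of_nat r * of_nat s - of_nat s - 2) * fps_X
           - (of_nat r * of_nat s - 1) * fps_X ^ 2
           + of_nat s * fps_X ^ (r + 1))
        / (1 - 2 * (of_nat s + 1) * fps_X
             + (of_nat s + 1) ^ 2 * fps_X ^ 2
             + of_nat s * fps_X ^ (r + 1)
             - of_nat s ^ 2 * (of_nat r + 1) * fps_X ^ (r + 2)
             + of_nat s * (of_nat r * of_nat s - 1) * fps_X ^ (r + 3))"
proof (rule fps_eq_divideI)
  have "s \<le> k" using assms by simp
  \<comment> \<open>Split off \<open>fps_X ^ r\<close>, which takes the place of P in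
    \<open>eliminate_low\<close>.\<close>
  have pow: "fps_X ^ (r + 1) = fps_X * fps_X ^ r" "fps_X ^ (r + 2) = fps_X ^ 2 * fps_X ^ r"
    "fps_X ^ (r + 3) = fps_X ^ 3 * (fps_X ^ r :: real fps)"
    by (simp_all add: power_add power2_eq_square power3_eq_cube mult_ac)
  have A: "vertex_gf k s = 1 + fps_X * ((of_nat s + 1) * vertex_gf k s
      + (of_nat s * (of_nat r + 1) - (of_nat s + 1)) * low_gf k s)"
    using vertex_gf_eq[OF \<open>s \<le> k\<close>] assms by (simp only: of_nat_add of_nat_mult of_nat_1)
  show "vertex_gf k s * (1 - 2 * (of_nat s + 1) * fps_X
             + (of_nat s + 1) ^ 2 * fps_X ^ 2
             + of_nat s * fps_X ^ (r + 1)
             - of_nat s ^ 2 * (of_nat r + 1) * fps_X ^ (r + 2)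
             + of_nat s * (of_nat r * of_nat s - 1) * fps_X ^ (r + 3))
      = 1 + (of_nat r * of_nat s - of_nat s - 2) * fps_X
           - (of_nat r * of_nat s - 1) * fps_X ^ 2
           + of_nat s * fps_X ^ (r + 1)"
    unfolding pow by (rule eliminate_low[OF A low_gf_eq_multiple[OF assms]])
qed simp

theorem theorem1p2:
  fixes k s :: nat
  assumes "k > 0" and "s > 0"
  shows "(int s \<in> {\<lceil>real k / 2\<rceil>..int k} \<longrightarrow>
      vertex_gf k s =
        1 / (1 - of_nat k * fps_X
               + (of_nat k - of_nat s) * (of_nat k - of_nat s - 1) * fps_X ^ 2))
    \<and> (\<forall>r :: nat. k = s * (r + 1) \<longrightarrow>
      vertex_gf k s =
        (1 + (of_nat r * of_nat s - of_nat s - 2) * fps_X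
           - (of_nat r * of_nat s - 1) * fps_X ^ 2
           + of_nat s * fps_X ^ (r + 1))
        / (1 - 2 * (of_nat s + 1) * fps_X
             + (of_nat s + 1) ^ 2 * fps_X ^ 2
             + of_nat s * fps_X ^ (r + 1)
             - of_nat s ^ 2 * (of_nat r + 1) * fps_X ^ (r + 2)
             + of_nat s * (of_nat r * of_nat s - 1) * fps_X ^ (r + 3)))
    \<and> (s = 1 \<longrightarrow>
      vertex_gf k 1 =
        (1 + (of_nat k - 4) * fps_X - (of_nat k - 2) * fps_X ^ 2 + fps_X ^ k)
        / (1 - 4 * fps_X + 4 * fps_X ^ 2 + fps_X ^ k
             - of_nat k * fps_X ^ (k + 1)
             + (of_nat k - 2) * fps_X ^ (k + 2)))"
proof (intro conjI impI allI)
  assume "int s \<in> {\<lceil>real k / 2\<rceil>..int k}"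
  then have "s \<le> k" "k \<le> 2 * s" by (auto simp: ceiling_le_iff)
  then show "vertex_gf k s = 1 / (1 - of_nat k * fps_X
               + (of_nat k - of_nat s) * (of_nat k - of_nat s - 1) * fps_X ^ 2)"
    by (rule vertex_gf_half)
next
  fix r assume "k = s * (r + 1)"
  then show "vertex_gf k s =
        (1 + (of_nat r * of_nat s - of_nat s - 2) * fps_X
           - (of_nat r * of_nat s - 1) * fps_X ^ 2
           + of_nat s * fps_X ^ (r + 1))
        / (1 - 2 * (of_nat s + 1) * fps_X
             + (of_nat s + 1) ^ 2 * fps_X ^ 2
             + of_nat s * fps_X ^ (r + 1)
             - of_nat s ^ 2 * (of_nat r + 1) * fps_X ^ (r + 2)
             + of_nat s * (of_nat r * of_nat s - 1) * fps_X ^ (r + 3))"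
    by (rule vertex_gf_multiple)
next
  \<comment> \<open>For s = 1 the second case always applies, with r = k - 1.\<close>
  obtain r where r: "k = Suc r" using assms(1) gr0_implies_Suc by blast
  show "vertex_gf k 1 =
        (1 + (of_nat k - 4) * fps_X - (of_nat k - 2) * fps_X ^ 2 + fps_X ^ k)
        / (1 - 4 * fps_X + 4 * fps_X ^ 2 + fps_X ^ k
             - of_nat k * fps_X ^ (k + 1)
             + (of_nat k - 2) * fps_X ^ (k + 2))"
    using vertex_gf_multiple[of k 1 r] by (simp add: r numeral_eq_Suc algebra_simps)
qed

end
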